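(* For any pair of twin stalactic tableaux $(T_L,T_R)$ as input, Algorithm EmSt (defined in the context) computes a word belonging to the $\equiv_{\mathrm{mSt}}$-equivalence class encoded by $(T_L,T_R)$; that is, its output $w$ satisfies $\mathrm{P}_{\mathrm{mSt}}(w) = (T_L,T_R)$.
   Context: A stalactic tableau is a top-aligned finite sequence of nonempty columns of cells, labelled by $\mathbb{N}=\{1,2,\dots\}$, such that all cells in a column have the same label and distinct columns have distinct labels. For a stalactic tableau $T$: $\mathrm{supp}(T)$ is its set of column labels; $\mathrm{cont}(T)$ records for each letter the number of cells labelled by it; $\rho_T(c)$ is the position from the left of the column labelled $c$; a column is simple if it has exactly one cell. A pair $(T_L,T_R)$ of stalactic tableaux is a pair of twin stalactic tableaux if $\mathrm{cont}(T_L)=\mathrm{cont}(T_R)$ and, for each simple column labelled $c$ and any other column labelled $d$, $\rho_{T_L}(c)<\rho_{T_L}(d)$ implies $\rho_{T_R}(c)<\rho_{T_R}(d)$. For a word $w$ over $\mathbb{N}$, $\mathrm{P}^{\to}_{\mathrm{lSt}}(w)$ is obtained from the empty tableau by reading $w$ left to right and inserting letters: to insert $a$, if $a$ labels no cell, add a new one-cell column labelled $a$ at the right; otherwise add a cell labelled $a$ to the bottom of the column labelled $a$. $\mathrm{P}^{\leftarrow}_{\mathrm{rSt}}(w)$ is obtained in the same way reading $w$ right to left and adding new columns at the left. $\mathrm{P}_{\mathrm{mSt}}(w)=(\mathrm{P}^{\to}_{\mathrm{lSt}}(w),\mathrm{P}^{\leftarrow}_{\mathrm{rSt}}(w))$.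 Two words are $\equiv_{\mathrm{mSt}}$-congruent iff they have the same $\mathrm{P}_{\mathrm{mSt}}$; the class encoded by $(T_L,T_R)$ is the set of words $w$ with $\mathrm{P}_{\mathrm{mSt}}(w)=(T_L,T_R)$. Algorithm EmSt. Input: $(T_L,T_R)$. Start with $u$ the empty word. While $T_L$ is nonempty: let $a$ be the label and $m_a$ the length of the leftmost column of $T_L$, and remove this column from $T_L$; if $m_a>1$, replace $u$ by $u\,a^{m_a-1}$; otherwise (if $m_a=1$), while $a\in\mathrm{supp}(T_R)$: let $b$ be the label of the leftmost column of $T_R$, replace $u$ by $ub$, and remove the leftmost column of $T_R$. When $T_L$ is empty, let $z$ be the reading of the top row of the remaining $T_R$ from left to right, and return the word $uz$. *)

theory Defs
  imports Main
begin

text \<open>Letters are positive natural numbers. A tableau is the list of its columns from left to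
  right, and a column is the list of its cell labels from top to bottom.\<close>

type_synonym word = "nat list"
type_synonym tableau = "nat list list"

definition words :: "word set" where
  "words = {w. \<forall>a\<in>set w. 1 \<le> a}"

text \<open>Meaningful for nonempty columns whose cells all have the same label.\<close>

definition label :: "nat list \<Rightarrow> nat" where
  "label C = hd C"

definition stalactic :: "tableau \<Rightarrow> bool" where
  "stalactic T \<longleftrightarrow>
     (\<forall>C\<in>set T. C \<noteq> [] \<and> (\<forall>x\<in>set C. 1 \<le> x) \<and> (\<forall>x\<in>set C. \<forall>y\<in>set C. x = y)) \<and>
     distinct (map label T)"

definition supp :: "tableau \<Rightarrow> nat set" where
  "supp T = label ` set T"

definition cont :: "tableau \<Rightarrow> nat \<Rightarrow> nat" where
  "cont T = (\<lambda>a. count_list (concat T) a)"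

text \<open>The position is counted from 1, and meaningful only for \<open>c\<close> in the support of a
  stalactic tableau, where the description is unique.\<close>

definition pos :: "tableau \<Rightarrow> nat \<Rightarrow> nat" ("\<rho>") where
  "\<rho> T c = Suc (THE i. i < length T \<and> label (T ! i) = c)"

definition simple :: "nat list \<Rightarrow> bool" where
  "simple C \<longleftrightarrow> length C = 1"

text \<open>Simple columns of \<open>T\<^sub>L\<close> and of \<open>T\<^sub>R\<close> have the same labels, since the contents agree.\<close>

definition twin_stalactic :: "tableau \<Rightarrow> tableau \<Rightarrow> bool" where
  "twin_stalactic T\<^sub>L T\<^sub>R \<longleftrightarrow>
     stalactic T\<^sub>L \<and> stalactic T\<^sub>R \<and> cont T\<^sub>L = cont T\<^sub>R \<and>
     (\<forall>C\<in>set T\<^sub>L. \<forall>D\<in>set T\<^sub>L. simple C \<and> D \<noteq> C \<longrightarrow>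
        \<rho> T\<^sub>L (label C) < \<rho> T\<^sub>L (label D) \<longrightarrow> \<rho> T\<^sub>R (label C) < \<rho> T\<^sub>R (label D))"

definition add_cell :: "nat \<Rightarrow> tableau \<Rightarrow> tableau" where
  "add_cell a T = map (\<lambda>C. if label C = a then C @ [a] else C) T"

definition insert_lSt :: "nat \<Rightarrow> tableau \<Rightarrow> tableau" where
  "insert_lSt a T = (if a \<notin> supp T then T @ [[a]] else add_cell a T)"

definition insert_rSt :: "nat \<Rightarrow> tableau \<Rightarrow> tableau" where
  "insert_rSt a T = (if a \<notin> supp T then [a] # T else add_cell a T)"

text \<open>\<open>fold\<close> inserts the first letter of the word first, \<open>foldr\<close> the last one.\<close>

definition P_lSt :: "word \<Rightarrow> tableau" where
  "P_lSt w = fold insert_lSt w []"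

definition P_rSt :: "word \<Rightarrow> tableau" where
  "P_rSt w = foldr insert_rSt w []"

definition P_mSt :: "word \<Rightarrow> tableau \<times> tableau" where
  "P_mSt w = (P_lSt w, P_rSt w)"

definition mSt_class :: "tableau \<times> tableau \<Rightarrow> word set" where
  "mSt_class P = {w \<in> words. P_mSt w = P}"

text \<open>The two while loops are written as tail recursions whose arguments are the program
  variables. Inner loop: while \<open>a\<close> is in the support of \<open>T\<^sub>R\<close>, move the label of the leftmost
  column of \<open>T\<^sub>R\<close> to the end of \<open>u\<close>; the result is the new \<open>(u, T\<^sub>R)\<close>.\<close>

fun EmSt_inner :: "nat \<Rightarrow> word \<Rightarrow> tableau \<Rightarrow> word \<times> tableau" where
  "EmSt_inner a u [] = (u, [])"
| "EmSt_inner a u (B # T\<^sub>R) =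
     (if a \<in> supp (B # T\<^sub>R) then EmSt_inner a (u @ [label B]) T\<^sub>R else (u, B # T\<^sub>R))"

fun EmSt_outer :: "word \<Rightarrow> tableau \<Rightarrow> tableau \<Rightarrow> word" where
  "EmSt_outer u [] T\<^sub>R = u @ map hd T\<^sub>R"
| "EmSt_outer u (A # T\<^sub>L) T\<^sub>R =
     (if length A > 1
      then EmSt_outer (u @ replicate (length A - 1) (label A)) T\<^sub>L T\<^sub>R
      else (case EmSt_inner (label A) u T\<^sub>R of (u', T\<^sub>R') \<Rightarrow> EmSt_outer u' T\<^sub>L T\<^sub>R'))"

definition EmSt :: "tableau \<Rightarrow> tableau \<Rightarrow> word" where
  "EmSt T\<^sub>L T\<^sub>R = EmSt_outer [] T\<^sub>L T\<^sub>R"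

end

theory Submission
  imports Defs
begin

text \<open>The first component of \<open>P_mSt w\<close> records the order of the first occurrences of the letters
  of \<open>w\<close>, the second one that of the last occurrences, and both record the multiplicities. At every
  moment of the algorithm, let \<open>u\<close> be the word built so far and \<open>R\<^sub>2\<close> the list of labels of what
  remains of \<open>T\<^sub>R\<close>. The last occurrences in \<open>u R\<^sub>2\<close> always read as the labels of \<open>T\<^sub>R\<close>: a simple
  column leaves \<open>u R\<^sub>2\<close> unchanged, and a column with \<open>m > 1\<close> cells inserts copies of a letter that
  still occurs in \<open>R\<^sub>2\<close>. The first occurrences in \<open>u\<close> read as the processed labels of \<open>T\<^sub>L\<close>: the
  twin condition says that every letter moved from \<open>T\<^sub>R\<close> before the label of a simple column has
  already been processed.\<close>

section \<open>Orders of first and last occurrences in a word\<close>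

text \<open>\<open>remdups\<close> keeps the last occurrence of each letter, so it serves directly
  for last occurrences; first occurrences need the two reversals.\<close>

definition first_occs :: "'a list \<Rightarrow> 'a list" where
  "first_occs w = rev (remdups (rev w))"

lemma set_first_occs [simp]: "set (first_occs w) = set w"
  by (simp add: first_occs_def)

lemma first_occs_Nil [simp]: "first_occs [] = []"
  by (simp add: first_occs_def)

lemma first_occs_snoc:
  "first_occs (w @ [a]) = (if a \<in> set w then first_occs w else first_occs w @ [a])"
  by (simp add: first_occs_def)

lemma count_list_replicate: "count_list (replicate n a) b = (if a = b then n else 0)"
  by (induction n) auto

lemma count_list_distinct: "distinct xs \<Longrightarrow> a \<in> set xs \<Longrightarrow> count_list xs a = 1"
  by (induction xs) auto

lemma remdups_append_absorb: "set ys \<subseteq> set zs \<Longrightarrow> remdups (ys @ zs) = remdups zs"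
  by (induction ys) auto

lemma first_occs_append_absorb: "set v \<subseteq> set u \<Longrightarrow> first_occs (u @ v) = first_occs u"
  unfolding first_occs_def by (simp add: remdups_append_absorb)

text \<open>Inserting copies of letters that recur later creates no last occurrence. This covers the
  insertions made for non-simple columns.\<close>

lemma remdups_insert_absorb:
  "set ys \<subseteq> set zs \<Longrightarrow> remdups (xs @ ys @ zs) = remdups (xs @ zs)"
  by (metis remdups_append2 remdups_append_absorb)

section \<open>The insertion algorithms in closed form\<close>

text \<open>A common normal form for outputs of insertion and for arbitrary stalactic tableaux:
  comparing them reduces to comparing label orders and multiplicities.\<close>

definition tableau_of :: "(nat \<Rightarrow> nat) \<Rightarrow> nat list \<Rightarrow> tableau" where
  "tableau_of m xs = map (\<lambda>a. replicate (m a) a) xs"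

lemma supp_tableau_of:
  assumes "\<forall>a\<in>set xs. 0 < m a"
  shows "supp (tableau_of m xs) = set xs"
  using assms by (force simp: supp_def tableau_of_def label_def image_image)

lemma add_cell_tableau_of:
  assumes "\<forall>b\<in>set xs. 0 < m b"
  shows "add_cell a (tableau_of m xs) = tableau_of (m(a := Suc (m a))) xs"
  using assms by (auto simp: add_cell_def tableau_of_def label_def replicate_append_same)

lemma tableau_of_cong:
  "(\<And>a. a \<in> set xs \<Longrightarrow> m a = n a) \<Longrightarrow> tableau_of m xs = tableau_of n xs"
  by (simp add: tableau_of_def)

lemma count_list_pos: "\<forall>a\<in>set w. 0 < count_list w a"
  by (metis count_list_0_iff gr0I)

text \<open>The head of the word is inserted last. It opens a new leftmost column exactly when it
  does not occur in the tail, which is when \<open>remdups\<close> keeps it.\<close>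

lemma P_rSt_eq: "P_rSt w = tableau_of (count_list w) (remdups w)"
proof (induction w)
  case Nil
  show ?case by (simp add: P_rSt_def tableau_of_def)
next
  case (Cons x w)
  have step: "P_rSt (x # w) = insert_rSt x (tableau_of (count_list w) (remdups w))"
    using Cons by (simp add: P_rSt_def)
  have supp: "supp (tableau_of (count_list w) (remdups w)) = set w"
    by (simp add: supp_tableau_of count_list_pos)
  show ?case
  proof (cases "x \<in> set w")
    case True
    then have "P_rSt (x # w) = tableau_of ((count_list w)(x := Suc (count_list w x))) (remdups w)"
      by (simp add: step insert_rSt_def supp add_cell_tableau_of count_list_pos)
    then show ?thesis
      using True by (auto intro!: tableau_of_cong)
  next
    case False
    then have "P_rSt (x # w) = [x] # tableau_of (count_list w) (remdups w)"
      by (simp add: step insert_rSt_def supp)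
    then show ?thesis
      using False by (auto simp: tableau_of_def)
  qed
qed

text \<open>Mirror image of the previous argument: the last letter is inserted last, so the
  induction peels words from the right.\<close>

lemma P_lSt_eq: "P_lSt w = tableau_of (count_list w) (first_occs w)"
proof (induction w rule: rev_induct)
  case Nil
  show ?case by (simp add: P_lSt_def tableau_of_def)
next
  case (snoc x w)
  have step: "P_lSt (w @ [x]) = insert_lSt x (tableau_of (count_list w) (first_occs w))"
    using snoc by (simp add: P_lSt_def)
  have supp: "supp (tableau_of (count_list w) (first_occs w)) = set w"
    by (simp add: supp_tableau_of count_list_pos)
  show ?case
  proof (cases "x \<in> set w")
    case True
    then have "P_lSt (w @ [x]) = tableau_of ((count_list w)(x := Suc (count_list w x))) (first_occs w)"
      by (simp add: step insert_lSt_def supp add_cell_tableau_of count_list_pos)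
    then show ?thesis
      using True by (auto simp: first_occs_snoc intro!: tableau_of_cong)
  next
    case False
    then have "P_lSt (w @ [x]) = tableau_of (count_list w) (first_occs w) @ [[x]]"
      by (simp add: step insert_lSt_def supp)
    then show ?thesis
      using False by (auto simp: tableau_of_def first_occs_snoc)
  qed
qed

section \<open>Stalactic tableaux recovered from content and label order\<close>

lemma column_eq_replicate:
  assumes "stalactic T" "C \<in> set T"
  shows "C = replicate (length C) (label C)"
proof -
  have "C \<noteq> []" "\<forall>x\<in>set C. \<forall>y\<in>set C. x = y"
    using assms by (auto simp: stalactic_def)
  then show ?thesis
    by (metis hd_in_set label_def replicate_eqI)
qed

text \<open>Every other column consists of copies of a different label, so only \<open>C\<close>
  contributes to the count.\<close>

lemma cont_label:
  assumes "stalactic T" "C \<in> set T"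
  shows "cont T (label C) = length C"
proof -
  obtain xs ys where T: "T = xs @ C # ys"
    using assms(2) by (meson split_list)
  have other: "label C \<notin> set D" if "D \<in> set (xs @ ys)" for D
  proof
    assume "label C \<in> set D"
    moreover have "D = replicate (length D) (label D)"
      using column_eq_replicate[OF assms(1), of D] that T by auto
    ultimately have "label D = label C"
      by (metis in_set_replicate)
    moreover have "label C \<notin> label ` set (xs @ ys)"
      using assms(1) by (auto simp: T stalactic_def)
    ultimately show False
      using that by (metis imageI)
  qed
  have "count_list C (label C) = length C"
    using column_eq_replicate[OF assms] by (metis count_list_replicate)
  moreover have "count_list (concat xs) (label C) = 0" "count_list (concat ys) (label C) = 0"
    using other by (auto simp: count_list_0_iff)
  ultimately show ?thesis
    by (simp add: cont_def T)
qed

lemma stalactic_eq_tableau_of: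
  assumes "stalactic T"
  shows "tableau_of (cont T) (map label T) = T"
proof -
  have "replicate (cont T (label C)) (label C) = C" if "C \<in> set T" for C
    using column_eq_replicate[OF assms that] cont_label[OF assms that] by simp
  then show ?thesis
    by (simp add: tableau_of_def map_idI)
qed

text \<open>Used to conclude that twin tableaux, having equal contents, have the same label
  set.\<close>

lemma supp_eq_cont:
  assumes "stalactic T"
  shows "supp T = {a. cont T a \<noteq> 0}"
proof -
  have "a \<in> supp T \<longleftrightarrow> a \<in> set (concat T)" for a
  proof
    assume "a \<in> supp T"
    then obtain C where "C \<in> set T" "a = hd C"
      by (auto simp: supp_def label_def)
    moreover have "C \<noteq> []"
      using assms \<open>C \<in> set T\<close> by (simp add: stalactic_def)
    ultimately show "a \<in> set (concat T)"
      using hd_in_set by fastforce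
  next
    assume "a \<in> set (concat T)"
    then obtain C where "C \<in> set T" "a \<in> set C"
      by auto
    then show "a \<in> supp T"
      using column_eq_replicate[OF assms, of C] by (metis imageI in_set_replicate supp_def)
  qed
  then show ?thesis
    by (auto simp: cont_def count_list_0_iff)
qed

section \<open>Column positions and the twin condition\<close>

lemma pos_split:
  assumes "distinct (map label T)" "map label T = xs @ a # ys"
  shows "\<rho> T a = Suc (length xs)"
proof -
  have len: "length xs < length T"
    using assms(2) by (metis length_map length_append length_Cons less_add_Suc1 add_Suc_right)
  have lab: "label (T ! length xs) = a"
    using assms(2) len by (metis nth_append_length nth_map)
  have "(THE i. i < length T \<and> label (T ! i) = a) = length xs"
  proof (rule the_equality)
    fix i assume "i < length T \<and> label (T ! i) = a"
    then show "i = length xs"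
      using assms(1) len lab by (metis length_map nth_eq_iff_index_eq nth_map)
  qed (use len lab in simp)
  then show ?thesis by (simp add: pos_def)
qed

text \<open>A letter left of \<open>a\<close> in \<open>T\<^sub>R\<close> but right of it in
  \<open>T\<^sub>L\<close> would violate the twin condition at the simple column of
  \<open>a\<close>.\<close>

lemma twin_prefix_subset:
  assumes twin: "twin_stalactic T\<^sub>L T\<^sub>R"
    and L: "map label T\<^sub>L = xs @ a # ys" and R: "map label T\<^sub>R = xs' @ a # ys'"
    and simple: "cont T\<^sub>L a = 1"
  shows "set xs' \<subseteq> set xs"
proof
  fix b assume "b \<in> set xs'"
  then obtain us vs where xs': "xs' = us @ b # vs"
    by (meson split_list)
  have stal: "stalactic T\<^sub>L" "stalactic T\<^sub>R" and cont: "cont T\<^sub>L = cont T\<^sub>R"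
    using twin by (auto simp: twin_stalactic_def)
  have dist: "distinct (map label T\<^sub>L)" "distinct (map label T\<^sub>R)"
    using stal by (auto simp: stalactic_def)
  have "set (map label T\<^sub>L) = set (map label T\<^sub>R)"
    using supp_eq_cont[OF stal(1)] supp_eq_cont[OF stal(2)] cont by (simp add: supp_def)
  then have "b \<in> set (xs @ a # ys)"
    using L R xs' by auto
  moreover have "a \<noteq> b"
    using dist(2) R xs' by auto
  moreover have "b \<notin> set ys"
  proof
    assume "b \<in> set ys"
    then obtain us' vs' where ys: "ys = us' @ b # vs'"
      by (meson split_list)
    obtain C where C: "C \<in> set T\<^sub>L" "label C = a"
      using L by (metis in_set_conv_decomp imageE set_map)
    obtain D where D: "D \<in> set T\<^sub>L" "label D = b"
      using L ys by (metis (no_types, lifting) Un_iff imageE in_set_conv_decomp list.set_intros(2)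
          set_append set_map)
    have "simple C"
      using simple cont_label[OF stal(1) C(1)] C(2) by (simp add: simple_def)
    moreover have "D \<noteq> C"
      using C D \<open>a \<noteq> b\<close> by auto
    moreover have "\<rho> T\<^sub>L a < \<rho> T\<^sub>L b"
      using pos_split[OF dist(1) L] pos_split[of T\<^sub>L "xs @ a # us'" b vs'] dist(1) L ys by simp
    ultimately have "\<rho> T\<^sub>R a < \<rho> T\<^sub>R b"
      using twin C D unfolding twin_stalactic_def by blast
    moreover have "\<rho> T\<^sub>R b < \<rho> T\<^sub>R a"
      using pos_split[OF dist(2) R] pos_split[of T\<^sub>R us b "vs @ a # ys'"] dist(2) R xs' by simp
    ultimately show False by simp
  qed
  ultimately show "b \<in> set xs" by auto
qed

section \<open>The loops of the algorithm and their invariant\<close>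

text \<open>Since \<open>a\<close> labels only one column, the guard holds up to and including that
  column and fails right after it.\<close>

lemma EmSt_inner_split:
  assumes "map label T = xs @ a # ys" "a \<notin> set xs" "a \<notin> set ys"
  obtains T' where "EmSt_inner a u T = (u @ xs @ [a], T')" "map label T' = ys"
  using assms
proof (induction xs arbitrary: u T thesis)
  case Nil
  then obtain B T' where T: "T = B # T'" "label B = a" "map label T' = ys"
    by auto
  then have "a \<notin> supp T'"
    using Nil.prems by (auto simp: supp_def)
  then have "EmSt_inner a (u @ [a]) T' = (u @ [a], T')"
    by (cases T') auto
  then show ?case
    using T Nil.prems(1) by (auto simp: supp_def)
next
  case (Cons x xs)
  then obtain B T0 where T: "T = B # T0" "label B = x" "map label T0 = xs @ a # ys"
    by auto
  then obtain T' where T': "EmSt_inner a (u @ [x]) T0 = ((u @ [x]) @ xs @ [a], T')" "map label T' = ys"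
    using Cons.IH[of "u @ [x]" T0] Cons.prems by auto
  have "a \<in> label ` set T0"
    using T(3) by (metis in_set_conv_decomp set_map)
  then show ?case
    using T T' Cons.prems(1)[of T'] by (auto simp: supp_def)
qed

text \<open>\<open>L\<^sub>1\<close> and \<open>R\<^sub>1\<close> are the labels of the columns
  already removed. Besides the two orders, the invariant tracks counts: in \<open>u\<close> followed
  by the remaining labels of \<open>T\<^sub>R\<close>, processed letters already have their final
  multiplicity, while the others occur only among those remaining labels. The assumption
  \<open>prefix\<close> is the twin condition in terms of label lists.\<close>

lemma EmSt_outer_correct:
  fixes L R :: "nat list" and m :: "nat \<Rightarrow> nat"
  assumes "distinct L" "distinct R" "set L = set R"
    and "\<forall>a. a \<notin> set L \<longrightarrow> m a = 0"
    and prefix: "\<And>xs a ys xs' ys'. \<lbrakk>m a = 1; L = xs @ a # ys; R = xs' @ a # ys'\<rbrakk> \<Longrightarrow> set xs' \<subseteq> set xs"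
    and "L = L\<^sub>1 @ map label T\<^sub>L" "R = R\<^sub>1 @ map label T\<^sub>R" "set R\<^sub>1 \<subseteq> set L\<^sub>1"
    and "\<forall>C\<in>set T\<^sub>L. length C = m (label C) \<and> 0 < m (label C)"
    and "first_occs u = L\<^sub>1" "remdups (u @ map label T\<^sub>R) = R"
    and "\<forall>a. count_list (u @ map label T\<^sub>R) a =
          (if a \<in> set L\<^sub>1 then m a else count_list (map label T\<^sub>R) a)"
  defines "w \<equiv> EmSt_outer u T\<^sub>L T\<^sub>R"
  shows "first_occs w = L \<and> remdups w = R \<and> count_list w = m"
  using assms(6-12) unfolding w_def
proof (induction T\<^sub>L arbitrary: L\<^sub>1 R\<^sub>1 T\<^sub>R u)
  case Nil
  have hd: "map hd T\<^sub>R = map label T\<^sub>R"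
    by (simp add: label_def)
  have set_u: "set u = set L\<^sub>1"
    using Nil.prems(5) by (metis set_first_occs)
  \<comment> \<open>All letters are processed by now, so the final top row adds no first
    occurrence.\<close>
  have "set (map label T\<^sub>R) \<subseteq> set u"
    using Nil.prems(1,2) assms(3) set_u by auto
  then have "first_occs (u @ map label T\<^sub>R) = L"
    using Nil.prems(1,5) by (simp add: first_occs_append_absorb)
  moreover have "count_list (u @ map label T\<^sub>R) a = m a" for a
  proof (cases "a \<in> set L\<^sub>1")
    case False
    then have "a \<notin> set (map label T\<^sub>R)" "m a = 0"
      using Nil.prems(1,2) assms(3,4) by auto
    then show ?thesis
      using Nil.prems(7) False by (metis count_list_0_iff)
  qed (use Nil.prems(7) in metis)
  ultimately show ?case
    using Nil.prems(6) by (auto simp: hd)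
next
  case (Cons A T\<^sub>L)
  define a where "a = label A"
  have set_u: "set u = set L\<^sub>1"
    using Cons.prems(5) by (metis set_first_occs)
  have L: "L = L\<^sub>1 @ a # map label T\<^sub>L"
    using Cons.prems(1) by (simp add: a_def)
  have a_L1: "a \<notin> set L\<^sub>1"
    using assms(1) L by simp
  \<comment> \<open>The unprocessed \<open>a\<close> cannot lie in \<open>R\<^sub>1\<close>, whose
    letters are all processed, so its column is still in \<open>T\<^sub>R\<close>.\<close>
  have a_R: "a \<in> set (map label T\<^sub>R)"
    using a_L1 L assms(3) Cons.prems(2,3)
    by (metis Un_iff in_set_conv_decomp set_append subsetD)
  have count_a: "count_list (map label T\<^sub>R) a = 1"
    using a_R assms(2) Cons.prems(2) by (metis distinct_append count_list_distinct)
  have len: "length A = m a" "0 < m a"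
    using Cons.prems(4) by (simp_all add: a_def)
  have cols: "\<forall>C\<in>set T\<^sub>L. length C = m (label C) \<and> 0 < m (label C)"
    using Cons.prems(4) by simp
  show ?case
  proof (cases "length A > 1")
    case True
    let ?v = "replicate (length A - 1) a"
    have v: "set ?v = {a}"
      using True by simp
    \<comment> \<open>The first copy supplies the first occurrence of \<open>a\<close>; the others
      are absorbed.\<close>
    have "?v = a # replicate (length A - 2) a"
      using True by (metis Suc_1 Suc_diff_Suc replicate_Suc)
    then have "first_occs (u @ ?v) = first_occs ((u @ [a]) @ replicate (length A - 2) a)"
      by simp
    also have "\<dots> = first_occs (u @ [a])"
      by (rule first_occs_append_absorb) auto
    also have "\<dots> = L\<^sub>1 @ [a]"
      using a_L1 set_u Cons.prems(5) by (simp add: first_occs_snoc)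
    finally have 1: "first_occs (u @ ?v) = L\<^sub>1 @ [a]" .
    have 2: "remdups ((u @ ?v) @ map label T\<^sub>R) = R"
      using remdups_insert_absorb[of ?v "map label T\<^sub>R" u] v a_R Cons.prems(6) by simp
    have 3: "count_list ((u @ ?v) @ map label T\<^sub>R) b =
          (if b \<in> set (L\<^sub>1 @ [a]) then m b else count_list (map label T\<^sub>R) b)" for b
    proof (cases "b = a")
      case True
      \<comment> \<open>The single copy still waiting in \<open>T\<^sub>R\<close> completes the
        \<open>m a - 1\<close> inserted ones to \<open>m a\<close>.\<close>
      have "count_list (u @ map label T\<^sub>R) a = 1"
        using Cons.prems(7) a_L1 count_a by metis
      then show ?thesis
        using True len by (simp add: count_list_replicate)
    next
      case False
      then have "count_list ?v b = 0"
        by (simp add: count_list_0_iff)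
      then show ?thesis
        using Cons.prems(7)[rule_format, of b] False by simp
    qed
    have "first_occs (EmSt_outer (u @ ?v) T\<^sub>L T\<^sub>R) = L \<and>
          remdups (EmSt_outer (u @ ?v) T\<^sub>L T\<^sub>R) = R \<and> count_list (EmSt_outer (u @ ?v) T\<^sub>L T\<^sub>R) = m"
      by (rule Cons.IH[of "L\<^sub>1 @ [a]" R\<^sub>1]) (use L Cons.prems(2,3) cols 1 2 3 in auto)
    then show ?thesis
      using True by (simp add: a_def)
  next
    case False
    then have m: "m a = 1"
      using len by simp
    obtain xs ys where xy: "map label T\<^sub>R = xs @ a # ys"
      using a_R by (meson split_list)
    then have a_xy: "a \<notin> set xs" "a \<notin> set ys"
      using assms(2) Cons.prems(2) by auto
    then obtain T' where T': "EmSt_inner a u T\<^sub>R = (u @ xs @ [a], T')" "map label T' = ys"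
      using EmSt_inner_split[OF xy] by metis
    have R: "R = (R\<^sub>1 @ xs) @ a # ys"
      using Cons.prems(2) xy by simp
    \<comment> \<open>Letters moved ahead of \<open>a\<close> are already processed, so
      \<open>a\<close> is the only new first occurrence.\<close>
    have sub: "set (R\<^sub>1 @ xs) \<subseteq> set L\<^sub>1"
      using prefix[OF m L R] .
    \<comment> \<open>Labels only change sides, so last occurrences and total counts carry
      over.\<close>
    have u': "(u @ xs @ [a]) @ map label T' = u @ map label T\<^sub>R"
      using xy T'(2) by simp
    have "first_occs (u @ xs) = L\<^sub>1"
      using sub set_u Cons.prems(5) by (simp add: first_occs_append_absorb)
    moreover have "a \<notin> set (u @ xs)"
      using a_xy a_L1 set_u by simp
    ultimately have 1: "first_occs (u @ xs @ [a]) = L\<^sub>1 @ [a]"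
      using first_occs_snoc[of "u @ xs" a] by simp
    have 2: "remdups ((u @ xs @ [a]) @ map label T') = R"
      using Cons.prems(6) u' by metis
    have 3: "count_list ((u @ xs @ [a]) @ map label T') b =
          (if b \<in> set (L\<^sub>1 @ [a]) then m b else count_list (map label T') b)" for b
    proof (cases "b \<in> set (L\<^sub>1 @ [a])")
      case True
      then show ?thesis
        using Cons.prems(7)[rule_format, of b] u' m count_a a_L1 by (auto split: if_splits)
    next
      case False
      \<comment> \<open>The moved letters are \<open>a\<close> and processed ones, so an unprocessed
        \<open>b\<close> keeps its count among the remaining labels.\<close>
      then have "count_list xs b = 0"
        using sub by (auto simp: count_list_0_iff)
      then show ?thesis
        using Cons.prems(7)[rule_format, of b] u' False xy T'(2) by auto
    qed
    have "first_occs (EmSt_outer (u @ xs @ [a]) T\<^sub>L T') = L \<and>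
          remdups (EmSt_outer (u @ xs @ [a]) T\<^sub>L T') = R \<and>
          count_list (EmSt_outer (u @ xs @ [a]) T\<^sub>L T') = m"
      by (rule Cons.IH[of "L\<^sub>1 @ [a]" "R\<^sub>1 @ xs @ [a]"]) (use L R T'(2) sub cols 1 2 3 in auto)
    then show ?thesis
      using False T'(1) by (simp add: a_def)
  qed
qed

theorem proposition4p18:
  fixes T\<^sub>L T\<^sub>R :: tableau
  assumes "twin_stalactic T\<^sub>L T\<^sub>R"
  shows "EmSt T\<^sub>L T\<^sub>R \<in> mSt_class (T\<^sub>L, T\<^sub>R)"
proof -
  let ?w = "EmSt T\<^sub>L T\<^sub>R"
  have stal: "stalactic T\<^sub>L" "stalactic T\<^sub>R" and cont: "cont T\<^sub>L = cont T\<^sub>R"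
    using assms by (auto simp: twin_stalactic_def)
  have dist: "distinct (map label T\<^sub>L)" "distinct (map label T\<^sub>R)"
    using stal by (auto simp: stalactic_def)
  have sets: "set (map label T\<^sub>L) = set (map label T\<^sub>R)"
    using supp_eq_cont[OF stal(1)] supp_eq_cont[OF stal(2)] cont by (simp add: supp_def)
  have zero: "\<forall>a. a \<notin> set (map label T\<^sub>L) \<longrightarrow> cont T\<^sub>L a = 0"
    using supp_eq_cont[OF stal(1)] by (auto simp: supp_def)
  have cols: "\<forall>C\<in>set T\<^sub>L. length C = cont T\<^sub>L (label C) \<and> 0 < cont T\<^sub>L (label C)"
    using stal(1) by (auto simp: cont_label stalactic_def)
  \<comment> \<open>Initially \<open>u\<close> is empty and no column is removed, so the invariant
    holds with \<open>m\<close> the common content.\<close>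
  have w: "first_occs ?w = map label T\<^sub>L \<and> remdups ?w = map label T\<^sub>R \<and> count_list ?w = cont T\<^sub>L"
    unfolding EmSt_def
    by (rule EmSt_outer_correct[where L\<^sub>1 = "[]" and R\<^sub>1 = "[]"])
      (use dist sets zero cols twin_prefix_subset[OF assms] in
        \<open>simp_all add: distinct_remdups_id\<close>)
  have "P_lSt ?w = T\<^sub>L" "P_rSt ?w = T\<^sub>R"
    using w stalactic_eq_tableau_of[OF stal(1)] stalactic_eq_tableau_of[OF stal(2)] cont
    by (simp_all add: P_lSt_eq P_rSt_eq)
  \<comment> \<open>Membership in the class also demands positive letters, which the labels
    are.\<close>
  moreover have "set ?w = label ` set T\<^sub>L"
    using w by (metis set_first_occs set_map)
  then have "?w \<in> words"
    using stal(1) by (auto simp: words_def stalactic_def label_def)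
  ultimately show ?thesis
    by (simp add: mSt_class_def P_mSt_def)
qed

end
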